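(* Let $n,m\ge 1$ be integers, let $\Gamma : D^m\to D^n$ be non-expansive, and define $$C_\Gamma := \{(\mathbf{x},\mathbf{y}) \in \mathbb{R}^n \times \mathbb{R}^m : \Gamma(\boldsymbol{\beta})^\top \mathbf{x} - \boldsymbol{\beta}^\top \mathbf{y} \ge 0 \ \text{ for all } \boldsymbol{\beta} \in D^m\}.$$ Then $C_\Gamma$ is a polyhedron if and only if there is a finite set $I\subseteq D^m$ such that for every $\overline{\boldsymbol{\beta}}\in D^m$ there exists a set $J\subseteq I$ of pairwise isometric points satisfying $\overline{\boldsymbol{\beta}}\in\operatorname{cone}(J)$. Moreover, for such a set $I$, $$C_\Gamma = \{(\mathbf{x},\mathbf{y}) \in \mathbb{R}^n \times \mathbb{R}^m : \Gamma(\boldsymbol{\beta})^\top \mathbf{x} - \boldsymbol{\beta}^\top \mathbf{y} \ge 0 \ \text{ for all } \boldsymbol{\beta} \in I\}.$$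
   Context: $\|\cdot\|$ is the Euclidean norm, and $D^k := \{\mathbf{x}\in\mathbb{R}^k : \|\mathbf{x}\|=1\}$. For a set $\mathcal{X}\subseteq\mathbb{R}^d$, $\operatorname{cone}(\mathcal{X})$ is the conic hull, i.e. the set of all finite combinations $\sum_{i=1}^t\lambda_i\mathbf{x}^i$ with $\lambda_i\ge0$ and $\mathbf{x}^i\in\mathcal{X}$. A function $\Gamma: D^m\to D^n$ is non-expansive if $\|\Gamma(\boldsymbol{\beta})-\Gamma(\boldsymbol{\beta}')\|\le\|\boldsymbol{\beta}-\boldsymbol{\beta}'\|$ for every pair of distinct points $\boldsymbol{\beta},\boldsymbol{\beta}'\in D^m$. Two points $\boldsymbol{\beta},\boldsymbol{\beta}'\in D^m$ are isometric (with respect to $\Gamma$) if $\|\Gamma(\boldsymbol{\beta})-\Gamma(\boldsymbol{\beta}')\|=\|\boldsymbol{\beta}-\boldsymbol{\beta}'\|$, equivalently $\Gamma(\boldsymbol{\beta})^\top\Gamma(\boldsymbol{\beta}')=\boldsymbol{\beta}^\top\boldsymbol{\beta}'$. A polyhedron is an intersection of finitely many closed half-spaces. *)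

theory Defs
  imports "HOL-Analysis.Analysis"
begin

text \<open>
  The unit sphere \<open>D\<^sup>k\<close> is \<^term>\<open>sphere 0 1 :: (real ^ 'k) set\<close>, so the dimension
  \<open>k = CARD('k) \<ge> 1\<close> lives in the type.  The set of finite conic combinations of \<open>S\<close> is
  \<^term>\<open>convex_cone hull S\<close>; the library's \<^const>\<open>cone\<close> and \<^const>\<open>conic\<close> hulls only take
  nonnegative multiples of single points.
\<close>

lemma convex_cone_hull_eq_conic_combinations:
  fixes S :: "'a::real_vector set"
  shows "convex_cone hull S =
    {\<Sum>i=1..t. l i *\<^sub>R x i | (t::nat) l x. \<forall>i\<in>{1..t}. 0 \<le> l i \<and> x i \<in> S}"
    (is "_ = ?R")
proof (rule hull_unique)
  show "S \<subseteq> ?R"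
  proof
    fix s assume "s \<in> S"
    then show "s \<in> ?R"
      by (intro CollectI exI[of _ "1::nat"] exI[of _ "\<lambda>_. 1"] exI[of _ "\<lambda>_. s"]) auto
  qed
  have add: "a + b \<in> ?R" if "a \<in> ?R" "b \<in> ?R" for a b
  proof -
    from that obtain t l x t' l' x' where
      a: "a = (\<Sum>i=1..t. l i *\<^sub>R x i)" "\<forall>i\<in>{1..t::nat}. 0 \<le> l i \<and> x i \<in> S" and
      b: "b = (\<Sum>i=1..t'. l' i *\<^sub>R x' i)" "\<forall>i\<in>{1..t'::nat}. 0 \<le> l' i \<and> x' i \<in> S"
      by blast
    define L where "L i = (if i \<le> t then l i else l' (i - t))" for i
    define X where "X i = (if i \<le> t then x i else x' (i - t))" for i
    have "(\<Sum>i=1..t+t'. L i *\<^sub>R X i) = (\<Sum>i=1..t. L i *\<^sub>R X i) + (\<Sum>i=t+1..t+t'. L i *\<^sub>R X i)"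
      by (rule sum.ub_add_nat) simp
    also have "(\<Sum>i=t+1..t+t'. L i *\<^sub>R X i) = (\<Sum>i=1..t'. L (i + t) *\<^sub>R X (i + t))"
      using sum.shift_bounds_cl_nat_ivl[of "\<lambda>i. L i *\<^sub>R X i" 1 t t'] by (simp add: add.commute)
    also have "\<dots> = b"
      unfolding b by (intro sum.cong) (auto simp: L_def X_def)
    also have "(\<Sum>i=1..t. L i *\<^sub>R X i) = a"
      unfolding a by (intro sum.cong) (auto simp: L_def X_def)
    finally have "a + b = (\<Sum>i=1..t+t'. L i *\<^sub>R X i)" by simp
    moreover have "\<forall>i\<in>{1..t+t'}. 0 \<le> L i \<and> X i \<in> S"
    proof
      fix i assume "i \<in> {1..t+t'}"
      then have "i \<in> {1..t} \<or> \<not> i \<le> t \<and> i - t \<in> {1..t'}" by auto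
      then show "0 \<le> L i \<and> X i \<in> S"
        using a(2) b(2) unfolding L_def X_def by (metis atLeastAtMost_iff)
    qed
    ultimately show ?thesis
      by (intro CollectI exI[of _ "t + t'"] exI[of _ L] exI[of _ X] conjI)
  qed
  have scale: "c *\<^sub>R a \<in> ?R" if "a \<in> ?R" "0 \<le> c" for a and c :: real
  proof -
    from that obtain t l x where
      a: "a = (\<Sum>i=1..t. l i *\<^sub>R x i)" "\<forall>i\<in>{1..t::nat}. 0 \<le> l i \<and> x i \<in> S"
      by blast
    then have "c *\<^sub>R a = (\<Sum>i=1..t. (c * l i) *\<^sub>R x i)" "\<forall>i\<in>{1..t}. 0 \<le> c * l i \<and> x i \<in> S"
      using that(2) by (auto simp: scaleR_sum_right)
    then show ?thesis
      by (intro CollectI exI[of _ t] exI[of _ "\<lambda>i. c * l i"] exI[of _ x]) simp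
  qed
  have "0 \<in> ?R"
    by (intro CollectI exI[of _ "0::nat"]) auto
  then show "convex_cone ?R"
    unfolding convex_cone_def convex_def conic_def
    by (intro conjI ballI allI impI add scale) auto
  show "?R \<subseteq> T" if "S \<subseteq> T" "convex_cone T" for T
  proof
    fix y assume "y \<in> ?R"
    then obtain t l x where
      y: "y = (\<Sum>i=1..t. l i *\<^sub>R x i)" "\<forall>i\<in>{1..t::nat}. 0 \<le> l i \<and> x i \<in> S"
      by blast
    have "(\<Sum>i\<in>A. l i *\<^sub>R x i) \<in> T" if "finite A" "A \<subseteq> {1..t}" for A
      using that
    proof (induction A)
      case empty
      then show ?case using \<open>convex_cone T\<close> by (simp add: convex_cone_contains_0)
    next
      case (insert i A)
      then have "0 \<le> l i" "x i \<in> T"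
        using y(2) \<open>S \<subseteq> T\<close> by blast+
      then have "l i *\<^sub>R x i \<in> T"
        using \<open>convex_cone T\<close> by (simp add: convex_cone_def conic_def)
      with insert \<open>convex_cone T\<close> show ?case by (simp add: convex_cone_add)
    qed
    then show "y \<in> T" using y(1) by simp
  qed
qed

definition cut_set :: "(real ^ 'm \<Rightarrow> real ^ 'n) \<Rightarrow> (real ^ 'm) set \<Rightarrow> ((real ^ 'n) \<times> (real ^ 'm)) set"
  where "cut_set \<Gamma> B = {(x, y). \<forall>\<beta>\<in>B. \<Gamma> \<beta> \<bullet> x - \<beta> \<bullet> y \<ge> 0}"

definition C_set :: "(real ^ 'm \<Rightarrow> real ^ 'n) \<Rightarrow> ((real ^ 'n) \<times> (real ^ 'm)) set"
  where "C_set \<Gamma> = cut_set \<Gamma> (sphere 0 1)"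

definition isometric_points :: "(real ^ 'm \<Rightarrow> real ^ 'n) \<Rightarrow> real ^ 'm \<Rightarrow> real ^ 'm \<Rightarrow> bool"
  where "isometric_points \<Gamma> \<beta> \<beta>' \<longleftrightarrow> norm (\<Gamma> \<beta> - \<Gamma> \<beta>') = norm (\<beta> - \<beta>')"

definition isometric_cover :: "(real ^ 'm \<Rightarrow> real ^ 'n) \<Rightarrow> (real ^ 'm) set \<Rightarrow> bool"
  where "isometric_cover \<Gamma> I \<longleftrightarrow> finite I \<and> I \<subseteq> sphere 0 1 \<and>
    (\<forall>b\<in>sphere 0 1. \<exists>J\<subseteq>I. pairwise (isometric_points \<Gamma>) J \<and> b \<in> convex_cone hull J)"

end

theory Submission
  imports Defs
begin

text \<open>
  The normals \<open>(\<Gamma> \<beta>, - \<beta>)\<close> of the cuts are null vectors of the Lorentz form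
  \<open>x \<bullet> x' - y \<bullet> y'\<close>; non-expansiveness says that this form is nonnegative on pairs of normals, and
  it vanishes exactly on the isometric pairs.  Hence a normal is a conic combination of other normals
  only if these are pairwise isometric, and conversely every conic combination of pairwise isometric
  points of the sphere lifts to the normals.  It remains to see that polyhedrality of the dual
  cone yields finitely many \<^emph>\<open>normals\<close> generating all others.  This follows from Farkas' lemma because
  the cone generated by the normals is always closed.
\<close>

section \<open>Convex cones\<close>

lemma convex_cone_linear_vimage:
  assumes "linear f" "convex_cone S"
  shows "convex_cone {x. f x \<in> S}"
  using assms
  by (auto simp: convex_cone_iff linear_0 linear_add linear_scale)

lemma convex_cone_sum:
  assumes "convex_cone S" "\<And>i. i \<in> I \<Longrightarrow> f i \<in> S"
  shows "sum f I \<in> S"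
  using assms(2)
  by (induction I rule: infinite_finite_induct)
    (auto intro: convex_cone_add convex_cone_contains_0 assms(1))

lemma convex_cone_closure:
  fixes S :: "'a::euclidean_space set"
  shows "convex_cone S \<Longrightarrow> convex_cone (closure S)"
  by (simp add: convex_cone_def conic_closure convex_closure)

lemma subspace_lineality:
  assumes "convex_cone S"
  shows "subspace {x. x \<in> S \<and> - x \<in> S}"
proof -
  have "- (x + y) \<in> S" if "- x \<in> S" "- y \<in> S" for x y
    using convex_cone_add[OF assms that] by (simp add: add.commute)
  moreover have "- (c *\<^sub>R x) \<in> S" if "- x \<in> S" "0 \<le> c" for c x
    using convex_cone_scaleR[OF assms \<open>0 \<le> c\<close> \<open>- x \<in> S\<close>] by simp
  ultimately show ?thesis
    using assms by (simp add: subspace_convex_cone_symmetric convex_cone_iff)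
qed

text \<open>The hull consists of the nonnegative multiples of the compact set
  \<open>convex hull S\<close>. Its missing the origin matters: a disc touching the origin generates
  a cone that is not closed.\<close>

lemma closed_convex_cone_hull_compact:
  fixes S :: "'a::euclidean_space set"
  assumes "compact S" "0 \<notin> convex hull S"
  shows "closed (convex_cone hull S)"
proof (cases "S = {}")
  case False
  then show ?thesis
    using assms closed_conic_hull[of "convex hull S"]
    by (simp add: convex_cone_hull_separate_nonempty compact_convex_hull)
qed simp

text \<open>Some coefficient of the vanishing combination is positive; solving for its vector does
  it. This is the test for pointedness of the cone.\<close>

lemma exists_neg_of_zero_in_convex_hull:
  fixes S :: "'a::real_vector set"
  assumes "0 \<in> convex hull S"
  shows "\<exists>s\<in>S. - s \<in> convex_cone hull S"
proof -
  obtain T u where T: "finite T" "T \<subseteq> S" "\<forall>x\<in>T. 0 \<le> u x" "sum u T = 1"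
      and 0: "(\<Sum>x\<in>T. u x *\<^sub>R x) = 0"
    using assms unfolding convex_hull_explicit by blast
  from T have "\<exists>s\<in>T. u s \<noteq> 0"
    by (metis sum.neutral zero_neq_one)
  then obtain s where s: "s \<in> T" "u s > 0"
    using T by force
  have "u s *\<^sub>R s + (\<Sum>x\<in>T - {s}. u x *\<^sub>R x) = 0"
    using 0 T s by (simp add: sum.remove)
  then have eq: "u s *\<^sub>R (- s) = (\<Sum>x\<in>T - {s}. u x *\<^sub>R x)"
    by (simp add: neg_eq_iff_add_eq_0)
  have "(\<Sum>x\<in>T - {s}. u x *\<^sub>R x) \<in> convex_cone hull S"
    using T by (intro convex_cone_sum[OF convex_cone_convex_cone_hull] convex_cone_hull_mul hull_inc)
      auto
  then have "inverse (u s) *\<^sub>R (u s *\<^sub>R (- s)) \<in> convex_cone hull S"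
    unfolding eq using s by (intro convex_cone_hull_mul) auto
  then show ?thesis
    using s T by (intro bexI[of _ s]) auto
qed

section \<open>Separation, polyhedral cones and finite generation\<close>

lemma separate_closed_convex_cone:
  fixes S :: "'a::euclidean_space set"
  assumes "convex_cone S" "closed S" "x \<notin> S"
  obtains z where "z \<bullet> x < 0" "\<And>y. y \<in> S \<Longrightarrow> 0 \<le> z \<bullet> y"
proof -
  obtain z b where z: "z \<bullet> x < b" "\<forall>y\<in>S. z \<bullet> y > b"
    using separating_hyperplane_closed_point[of S x] assms unfolding convex_cone_def by blast
  have b: "b < 0"
    using z convex_cone_contains_0[OF assms(1)] by force
  have "0 \<le> z \<bullet> y" if "y \<in> S" for y
  proof (rule ccontr)
    assume neg: "\<not> 0 \<le> z \<bullet> y"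
    \<comment> \<open>On this multiple of \<open>y\<close> the functional \<open>z\<close> takes
      exactly the value \<open>b\<close>, against the strict bound on \<open>S\<close>.\<close>
    then have "(b / (z \<bullet> y)) *\<^sub>R y \<in> S"
      using assms(1) that b by (intro convex_cone_scaleR) (auto simp: divide_nonpos_neg)
    then have "b < z \<bullet> ((b / (z \<bullet> y)) *\<^sub>R y)"
      using z by blast
    with neg show False by simp
  qed
  with z b show thesis by (intro that[of z]) auto
qed

text \<open>The points generated by finite subsets already form a convex cone containing
  \<open>S\<close>, since two finite subsets can be united.\<close>

lemma convex_cone_hull_finite_subset:
  assumes "x \<in> convex_cone hull S"
  obtains T where "finite T" "T \<subseteq> S" "x \<in> convex_cone hull T"
proof -
  define P where "P x \<longleftrightarrow> (\<exists>T. finite T \<and> T \<subseteq> S \<and> x \<in> convex_cone hull T)" for x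
  have zero: "P 0"
    unfolding P_def by (intro exI[of _ "{}"]) auto
  have add: "P (x + y)" if "P x" "P y" for x y
  proof -
    from that obtain T U where T: "finite T" "T \<subseteq> S" "x \<in> convex_cone hull T"
      and U: "finite U" "U \<subseteq> S" "y \<in> convex_cone hull U"
      unfolding P_def by blast
    have "convex_cone hull T \<subseteq> convex_cone hull (T \<union> U)"
        "convex_cone hull U \<subseteq> convex_cone hull (T \<union> U)"
      by (intro hull_mono Un_upper1 Un_upper2)+
    then have "x + y \<in> convex_cone hull (T \<union> U)"
      using T(3) U(3) by (intro convex_cone_hull_add) auto
    then show ?thesis
      using T(1,2) U(1,2) unfolding P_def by (intro exI[of _ "T \<union> U"]) simp
  qed
  have scale: "P (c *\<^sub>R x)" if "P x" "0 \<le> c" for c x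
    using that unfolding P_def by (meson convex_cone_hull_mul)
  have "P x"
    using assms
  proof (rule hull_induct)
    show "P x" if "x \<in> S" for x
      unfolding P_def using that by (intro exI[of _ "{x}"]) (simp add: hull_inc)
    show "convex_cone {x. P x}"
      using zero add scale by (simp add: convex_cone_iff)
  qed
  then obtain T where "finite T" "T \<subseteq> S" "x \<in> convex_cone hull T"
    unfolding P_def by blast
  then show thesis by (rule that)
qed

text \<open>A linear functional bounded above on a cone is nonpositive there, so every offset can be
  replaced by 0; the normals are then negated.\<close>

lemma polyhedral_cone_halfspaces:
  fixes S :: "'a::euclidean_space set"
  assumes "polyhedron S" "convex_cone S"
  obtains G where "finite G" "S = {x. \<forall>g\<in>G. 0 \<le> g \<bullet> x}"
proof -
  obtain F where F: "finite F" "S = \<Inter>F" "\<forall>h\<in>F. \<exists>a b. a \<noteq> 0 \<and> h = {x. a \<bullet> x \<le> b}"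
    using assms(1) unfolding polyhedron_def by blast
  then obtain a b where h: "\<And>h. h \<in> F \<Longrightarrow> h = {x. a h \<bullet> x \<le> b h}"
    by metis
  have S: "a h \<bullet> x \<le> b h" if "x \<in> S" "h \<in> F" for x h
    using F(2) that h by blast
  have b: "0 \<le> b h" if "h \<in> F" for h
    using S[OF convex_cone_contains_0[OF assms(2)] that] by simp
  have le: "a h \<bullet> x \<le> 0" if "x \<in> S" "h \<in> F" for x h
  proof (rule ccontr)
    assume neg: "\<not> a h \<bullet> x \<le> 0"
    \<comment> \<open>The scaling factor is chosen so that \<open>a h\<close> takes the forbidden
      value \<open>b h + 1\<close>.\<close>
    then have "((b h + 1) / (a h \<bullet> x)) *\<^sub>R x \<in> S"
      using that b[OF that(2)] by (intro convex_cone_scaleR[OF assms(2)]) auto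
    from S[OF this that(2)] neg show False by simp
  qed
  have "S = {x. \<forall>g\<in>(\<lambda>h. - a h) ` F. 0 \<le> g \<bullet> x}"
  proof (intro equalityI subsetI)
    fix x assume "x \<in> {x. \<forall>g\<in>(\<lambda>h. - a h) ` F. 0 \<le> g \<bullet> x}"
    then have "a h \<bullet> x \<le> b h" if "h \<in> F" for h
      using b[OF that] that by force
    then show "x \<in> S"
      using F(2) h by blast
  qed (use le in auto)
  with F(1) show thesis by (intro that[of "(\<lambda>h. - a h) ` F"]) auto
qed

text \<open>By Farkas' lemma, a closed cone is generated by the normals of any finite system of
  inequalities that describes its dual.\<close>

lemma finitely_generated_of_polyhedral_dual:
  fixes A :: "'a::euclidean_space set"
  assumes cl: "closed (convex_cone hull A)"
    and poly: "polyhedron {x. \<forall>a\<in>A. 0 \<le> a \<bullet> x}"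
  obtains T where "finite T" "T \<subseteq> A" "A \<subseteq> convex_cone hull T"
proof -
  define C where "C = {x. \<forall>a\<in>A. 0 \<le> a \<bullet> x}"
  have "convex_cone C"
    unfolding C_def by (simp add: convex_cone_iff inner_add_right)
  with poly obtain G where G: "finite G" "C = {x. \<forall>g\<in>G. 0 \<le> g \<bullet> x}"
    unfolding C_def[symmetric] by (rule polyhedral_cone_halfspaces)
  have "G \<subseteq> convex_cone hull A"
  proof
    fix g assume "g \<in> G"
    show "g \<in> convex_cone hull A"
    proof (rule ccontr)
      assume "g \<notin> convex_cone hull A"
      then obtain z where z: "z \<bullet> g < 0" "\<And>y. y \<in> convex_cone hull A \<Longrightarrow> 0 \<le> z \<bullet> y"
        using separate_closed_convex_cone[OF convex_cone_convex_cone_hull cl] by metis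
      then have "z \<in> C"
        unfolding C_def by (auto simp: inner_commute hull_inc)
      then have "0 \<le> g \<bullet> z"
        using G(2) \<open>g \<in> G\<close> by blast
      with z(1) show False by (simp add: inner_commute)
    qed
  qed
  \<comment> \<open>The vectors of \<open>G\<close> need not lie in \<open>A\<close>, so each is
    traded for finitely many elements of \<open>A\<close> that generate it.\<close>
  then have "\<forall>g\<in>G. \<exists>T. finite T \<and> T \<subseteq> A \<and> g \<in> convex_cone hull T"
    by (meson convex_cone_hull_finite_subset subsetD)
  then obtain T where T: "\<And>g. g \<in> G \<Longrightarrow> finite (T g) \<and> T g \<subseteq> A \<and> g \<in> convex_cone hull (T g)"
    by metis
  let ?T = "\<Union>g\<in>G. T g"
  have "g \<in> convex_cone hull ?T" if "g \<in> G" for g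
  proof -
    have "convex_cone hull (T g) \<subseteq> convex_cone hull ?T"
      using that by (intro hull_mono UN_upper)
    then show ?thesis
      using T[OF that] by auto
  qed
  then have sub: "convex_cone hull G \<subseteq> convex_cone hull ?T"
    by (intro hull_minimal convex_cone_convex_cone_hull) auto
  have "A \<subseteq> convex_cone hull G"
  proof
    fix a assume "a \<in> A"
    show "a \<in> convex_cone hull G"
    proof (rule ccontr)
      assume "a \<notin> convex_cone hull G"
      then obtain z where z: "z \<bullet> a < 0" "\<And>y. y \<in> convex_cone hull G \<Longrightarrow> 0 \<le> z \<bullet> y"
        using separate_closed_convex_cone[OF convex_cone_convex_cone_hull closed_convex_cone_hull]
          G(1) by metis
      then have "z \<in> C"
        unfolding G(2) by (auto simp: inner_commute hull_inc)
      then show False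
        using z(1) \<open>a \<in> A\<close> by (force simp: C_def inner_commute)
    qed
  qed
  with sub T G(1) show thesis
    by (intro that[of ?T]) auto
qed

text \<open>Here \<open>p\<close> projects onto the orthogonal complement of \<open>L\<close>, with
  kernel \<open>L\<close>: it removes the components along an orthonormal basis.\<close>

lemma orthogonal_projection_exists:
  fixes L :: "'a::euclidean_space set"
  assumes "subspace L"
  obtains p where "linear p" "\<And>x. x - p x \<in> L" "\<And>x l. l \<in> L \<Longrightarrow> l \<bullet> p x = 0"
proof -
  obtain B where B: "B \<subseteq> L" "pairwise orthogonal B" "\<And>x. x \<in> B \<Longrightarrow> norm x = 1"
      "independent B" "span B = L"
    using orthonormal_basis_subspace[OF assms] by metis
  define p where "p x = x - (\<Sum>b\<in>B. (b \<bullet> x) *\<^sub>R b)" for x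
  have fin: "finite B"
    using B(4) by (rule independent_imp_finite)
  have "linear p"
    unfolding p_def
    by (rule linearI) (simp_all add: inner_add_right scaleR_add_left sum.distrib
        scaleR_sum_right scaleR_diff_right)
  moreover have "x - p x \<in> L" for x
    unfolding p_def using B(1) assms by (auto intro!: subspace_sum subspace_scale)
  moreover have "l \<bullet> p x = 0" if "l \<in> L" for x l
  proof -
    have "orthogonal (p x) c" if "c \<in> B" for c
    proof -
      have "(\<Sum>b\<in>B. (b \<bullet> x) *\<^sub>R b) \<bullet> c = (\<Sum>b\<in>B. if b = c then c \<bullet> x else 0)"
        unfolding inner_sum_left
      proof (rule sum.cong)
        fix b assume "b \<in> B"
        then show "(b \<bullet> x) *\<^sub>R b \<bullet> c = (if b = c then c \<bullet> x else 0)"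
          using B(2) B(3)[of b] \<open>c \<in> B\<close>
          by (auto simp: pairwise_def orthogonal_def norm_eq_1)
      qed simp
      then show ?thesis
        using fin that by (simp add: p_def orthogonal_def inner_diff_left inner_commute[of x c])
    qed
    then show ?thesis
      using orthogonal_to_span[of l B "p x"] that B(5)
      by (simp add: orthogonal_def inner_commute)
  qed
  ultimately show thesis by (rule that)
qed

section \<open>Cut normals of a non-expansive map of spheres\<close>

definition lorentz :: "'a::real_inner \<times> 'b::real_inner \<Rightarrow> 'a \<times> 'b \<Rightarrow> real"
  where "lorentz z w = fst z \<bullet> fst w - snd z \<bullet> snd w"

lemma lorentz_simps:
  "lorentz (x + y) z = lorentz x z + lorentz y z"
  "lorentz z (x + y) = lorentz z x + lorentz z y"
  "lorentz (x - y) z = lorentz x z - lorentz y z"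
  "lorentz z (x - y) = lorentz z x - lorentz z y"
  "lorentz (c *\<^sub>R x) z = c * lorentz x z"
  "lorentz z (c *\<^sub>R x) = c * lorentz z x"
  "lorentz (- x) z = - lorentz x z"
  "lorentz z (- x) = - lorentz z x"
  "lorentz 0 z = 0"
  "lorentz z 0 = 0"
  by (simp_all add: lorentz_def inner_add_left inner_add_right inner_diff_left inner_diff_right
      right_diff_distrib)

lemma lorentz_commute: "lorentz z w = lorentz w z"
  by (simp add: lorentz_def inner_commute)

lemma lorentz_sum_left: "lorentz (\<Sum>i\<in>I. f i) w = (\<Sum>i\<in>I. lorentz (f i) w)"
  by (induction I rule: infinite_finite_induct) (auto simp: lorentz_simps)

lemma lorentz_sum_right: "lorentz w (\<Sum>i\<in>I. f i) = (\<Sum>i\<in>I. lorentz w (f i))"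
  by (induction I rule: infinite_finite_induct) (auto simp: lorentz_simps)

lemma lorentz_sum:
  "lorentz (\<Sum>i\<in>I. l i *\<^sub>R f i) (\<Sum>i\<in>I. l i *\<^sub>R f i) =
    (\<Sum>i\<in>I. \<Sum>j\<in>I. l i * l j * lorentz (f i) (f j))"
  unfolding lorentz_sum_left unfolding lorentz_sum_right
  by (simp add: lorentz_simps ac_simps)

text \<open>The minus sign turns a cut into nonnegativity of the Euclidean inner product with this
  pair.\<close>

definition cut_normal :: "('b::real_vector \<Rightarrow> 'a) \<Rightarrow> 'b \<Rightarrow> 'a \<times> 'b"
  where "cut_normal \<Gamma> b = (\<Gamma> b, - b)"

text \<open>The equality case of Cauchy-Schwarz for vectors of equal length.\<close>

lemma eq_if_inner_ge:
  fixes x y :: "'a::real_inner"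
  assumes "norm x = r" "norm y = r" "r\<^sup>2 \<le> x \<bullet> y"
  shows "x = y"
proof -
  have "(norm (x - y))\<^sup>2 \<le> 0"
    using assms by (simp add: dot_norm_neg)
  then show ?thesis by simp
qed

locale nonexpansive_sphere_map =
  fixes \<Gamma> :: "'b::euclidean_space \<Rightarrow> 'a::euclidean_space"
  assumes sphere: "\<Gamma> \<in> sphere 0 1 \<rightarrow> sphere 0 1"
    and lipschitz: "1-lipschitz_on (sphere 0 1) \<Gamma>"
begin

lemma norm_\<Gamma>: "norm b = 1 \<Longrightarrow> norm (\<Gamma> b) = 1"
  using sphere by (auto simp: Pi_iff)

lemma lorentz_cut_normal:
  assumes "norm b = 1" "norm c = 1"
  shows "lorentz (cut_normal \<Gamma> b) (cut_normal \<Gamma> c) =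
    ((norm (b - c))\<^sup>2 - (norm (\<Gamma> b - \<Gamma> c))\<^sup>2) / 2"
  using assms
  by (simp add: lorentz_def cut_normal_def dot_norm_neg norm_\<Gamma> diff_divide_distrib
      norm_minus_commute[of c b])

lemma lorentz_cut_normal_nonneg:
  assumes "norm b = 1" "norm c = 1"
  shows "0 \<le> lorentz (cut_normal \<Gamma> b) (cut_normal \<Gamma> c)"
proof -
  have "norm (\<Gamma> b - \<Gamma> c) \<le> norm (b - c)"
    using lipschitz_onD[OF lipschitz, of b c] assms by (simp add: dist_norm)
  then show ?thesis
    by (simp add: lorentz_cut_normal assms power_mono)
qed

lemma lorentz_cut_normal_eq_0_iff:
  assumes "norm b = 1" "norm c = 1"
  shows "lorentz (cut_normal \<Gamma> b) (cut_normal \<Gamma> c) = 0 \<longleftrightarrow> norm (\<Gamma> b - \<Gamma> c) = norm (b - c)"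
  by (auto simp: lorentz_cut_normal assms)

lemma lorentz_null_cut_normal: "norm b = 1 \<Longrightarrow> lorentz (cut_normal \<Gamma> b) (cut_normal \<Gamma> b) = 0"
  by (simp add: lorentz_cut_normal)

text \<open>Nullity gives both components of \<open>z\<close> the same norm \<open>r\<close>. The
  second component dictates \<open>b\<close>, and testing \<open>z\<close> against the normal at
  \<open>b\<close> forces equality in Cauchy-Schwarz, which fixes the first component as
  \<open>r *\<^sub>R \<Gamma> b\<close>.\<close>

lemma null_vector_is_cut_normal:
  assumes null: "lorentz z z = 0"
    and nonneg: "\<And>b. norm b = 1 \<Longrightarrow> 0 \<le> lorentz (cut_normal \<Gamma> b) z"
  shows "z = 0 \<or> (\<exists>c>0. \<exists>b. norm b = 1 \<and> z = c *\<^sub>R cut_normal \<Gamma> b)"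
proof (cases z)
  case (Pair x y)
  define r where "r = norm y"
  have x: "norm x = r"
    using null by (simp add: Pair lorentz_def r_def norm_eq)
  show ?thesis
  proof (cases "r = 0")
    case True
    then have "x = 0" "y = 0" using x by (auto simp: r_def)
    then show ?thesis by (simp add: Pair zero_prod_def)
  next
    case False
    then have r: "r > 0" by (simp add: r_def)
    define b where "b = - (y /\<^sub>R r)"
    have b: "norm b = 1"
      using r by (simp add: b_def r_def)
    have "b \<bullet> y = - r"
      using r by (simp add: b_def r_def dot_square_norm power2_eq_square)
    then have "r \<le> \<Gamma> b \<bullet> x"
      using nonneg[OF b] by (simp add: Pair lorentz_def cut_normal_def)
    then have "r\<^sup>2 \<le> (r *\<^sub>R \<Gamma> b) \<bullet> x"
      using r by (simp add: power2_eq_square)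
    moreover have "norm (r *\<^sub>R \<Gamma> b) = r"
      using r b by (simp add: norm_\<Gamma>)
    ultimately have "r *\<^sub>R \<Gamma> b = x"
      using x eq_if_inner_ge by blast
    moreover have "r *\<^sub>R b = - y"
      using r by (simp add: b_def)
    ultimately have "z = r *\<^sub>R cut_normal \<Gamma> b"
      by (simp add: Pair cut_normal_def)
    with r b show ?thesis
      by (intro disjI2 exI[of _ r] exI[of _ b] conjI)
  qed
qed

section \<open>Closedness of the cone of normals\<close>

abbreviation "normals \<equiv> cut_normal \<Gamma> ` sphere 0 1"

lemma compact_normals: "compact normals"
proof -
  have "continuous_on (sphere 0 1) (cut_normal \<Gamma>)"
    unfolding cut_normal_def
    by (intro continuous_intros lipschitz_on_continuous_on[OF lipschitz])
  then show ?thesis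
    by (rule compact_continuous_image) simp
qed

text \<open>For fixed \<open>w\<close> the condition \<open>0 \<le> lorentz w z\<close> cuts out a
  closed convex cone, so the sign passes from normals to the closure in one argument, then by
  symmetry in the other.\<close>

lemma lorentz_closure_nonneg:
  assumes "z \<in> closure (convex_cone hull normals)" "w \<in> closure (convex_cone hull normals)"
  shows "0 \<le> lorentz z w"
proof -
  let ?D = "closure (convex_cone hull normals)"
  have step: "?D \<subseteq> {z. 0 \<le> lorentz w z}" if "\<And>z. z \<in> normals \<Longrightarrow> 0 \<le> lorentz w z" for w
  proof (rule closure_minimal[OF hull_minimal])
    show "convex_cone {z. 0 \<le> lorentz w z}"
      by (simp add: convex_cone_iff lorentz_simps)
    show "closed {z. 0 \<le> lorentz w z}"
      unfolding lorentz_def by (intro closed_Collect_le continuous_intros)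
  qed (use that in auto)
  have "0 \<le> lorentz a z" if "a \<in> normals" "z \<in> ?D" for a z
  proof -
    have "?D \<subseteq> {z. 0 \<le> lorentz a z}"
      using that(1) by (intro step) (auto simp: lorentz_cut_normal_nonneg)
    with that(2) show ?thesis by blast
  qed
  then have "0 \<le> lorentz z a" if "a \<in> normals" "z \<in> ?D" for a z
    using that by (metis lorentz_commute)
  then show ?thesis
    using step[of z] assms by blast
qed

text \<open>Null vectors of the closure \<open>D\<close> are multiples of cut normals.  The lineality space \<open>L\<close> of
  \<open>D\<close> is orthogonal to \<open>D\<close> for the indefinite form, so both \<open>L\<close> and the projections of the normals
  to the Euclidean complement of \<open>L\<close> are null.  Modulo \<open>L\<close> the cone is therefore generated by the
  compact set \<open>S\<close> of normals perpendicular to \<open>L\<close>, and \<open>S\<close> generates a pointed closed cone.\<close>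

lemma closed_cone_normals: "closed (convex_cone hull normals)"
proof -
  let ?K = "convex_cone hull normals"
  define D where "D = closure ?K"
  define L where "L = {x. x \<in> D \<and> - x \<in> D}"
  have cc: "convex_cone D"
    unfolding D_def by (intro convex_cone_closure convex_cone_convex_cone_hull)
  have KD: "?K \<subseteq> D"
    unfolding D_def by (rule closure_subset)
  have AD: "cut_normal \<Gamma> b \<in> D" if "norm b = 1" for b
    using KD that by (auto intro!: hull_inc)
  have subL: "subspace L"
    unfolding L_def by (rule subspace_lineality[OF cc])
  have nonneg: "0 \<le> lorentz z w" if "z \<in> D" "w \<in> D" for z w
    using lorentz_closure_nonneg that unfolding D_def by blast
  have L0: "lorentz l w = 0" if "l \<in> L" "w \<in> D" for l w
    using nonneg[of l w] nonneg[of "- l" w] that by (auto simp: L_def lorentz_simps)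
  \<comment> \<open>By \<open>L0\<close> with \<open>w = l\<close>, each \<open>l\<close> in
    \<open>L\<close> is null, hence zero or a positive multiple of a single normal.\<close>
  have LK: "L \<subseteq> ?K"
  proof
    fix l assume l: "l \<in> L"
    then have "l \<in> D" by (simp add: L_def)
    then have "l = 0 \<or> (\<exists>c>0. \<exists>b. norm b = 1 \<and> l = c *\<^sub>R cut_normal \<Gamma> b)"
      using L0[OF l] nonneg AD by (intro null_vector_is_cut_normal) auto
    then show "l \<in> ?K"
      by (elim disjE exE conjE)
        (auto simp: convex_cone_hull_contains_0 intro!: convex_cone_hull_mul intro: hull_inc)
  qed
  obtain p where p: "linear p" "\<And>x. x - p x \<in> L" "\<And>x l. l \<in> L \<Longrightarrow> l \<bullet> p x = 0"
    using orthogonal_projection_exists[OF subL] by metis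
  define S where "S = normals \<inter> (\<Inter>l\<in>L. {x. l \<bullet> x = 0})"
  have SK: "convex_cone hull S \<subseteq> ?K"
    by (intro hull_mono) (auto simp: S_def)
  have "compact S"
    unfolding S_def
    by (intro compact_Int_closed compact_normals closed_INT ballI closed_hyperplane)
  \<comment> \<open>Otherwise some \<open>s\<close> in \<open>S\<close> lies in \<open>L\<close> and
    is also perpendicular to \<open>L\<close>, so it vanishes; but its second component is a unit
    vector.\<close>
  moreover have "0 \<notin> convex hull S"
  proof
    assume "0 \<in> convex hull S"
    then obtain s where s: "s \<in> S" "- s \<in> convex_cone hull S"
      using exists_neg_of_zero_in_convex_hull by blast
    then obtain b where b: "norm b = 1" "s = cut_normal \<Gamma> b"
      by (auto simp: S_def)
    then have "s \<in> L"
      using s(2) SK KD AD by (auto simp: L_def)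
    then have "s \<bullet> s = 0"
      using s(1) by (auto simp: S_def)
    then have "s = 0" by simp
    with b show False
      by (auto simp: cut_normal_def zero_prod_def)
  qed
  ultimately have clS: "closed (convex_cone hull S)"
    by (rule closed_convex_cone_hull_compact)
  have proj: "p (cut_normal \<Gamma> b) \<in> convex_cone hull S" if b: "norm b = 1" for b
  proof -
    define a where "a = cut_normal \<Gamma> b"
    define l where "l = a - p a"
    have l: "l \<in> L" and pa: "p a = a - l"
      using p(2) by (auto simp: l_def)
    have aD: "a \<in> D" and lD: "l \<in> D" "- l \<in> D"
      using AD[OF b] l by (auto simp: a_def L_def)
    have "a + - l \<in> D"
      using cc aD lD by (intro convex_cone_add)
    then have paD: "p a \<in> D"
      by (simp add: pa)
    \<comment> \<open>In the expansion for \<open>a - l\<close> the terms containing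
      \<open>l\<close> vanish by \<open>L0\<close>, and \<open>a\<close> is null.\<close>
    have "lorentz (p a) (p a) = 0"
      using L0[OF l aD] L0[OF l lD(1)] lorentz_null_cut_normal[OF b]
      by (simp add: pa lorentz_simps lorentz_commute[of a l] a_def[symmetric])
    then have "p a = 0 \<or> (\<exists>c>0. \<exists>v. norm v = 1 \<and> p a = c *\<^sub>R cut_normal \<Gamma> v)"
      using paD nonneg AD by (intro null_vector_is_cut_normal) auto
    then show ?thesis
      unfolding a_def[symmetric]
    proof (elim disjE exE conjE)
      fix c v assume c: "0 < c" "norm v = 1" "p a = c *\<^sub>R cut_normal \<Gamma> v"
      have "l \<bullet> cut_normal \<Gamma> v = 0" if "l \<in> L" for l
        using p(3)[OF that, of a] c by simp
      then have "cut_normal \<Gamma> v \<in> S"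
        using c by (auto simp: S_def)
      then show "p a \<in> convex_cone hull S"
        using c by (simp add: convex_cone_hull_mul hull_inc)
    qed (simp add: convex_cone_hull_contains_0)
  qed
  have "D \<subseteq> {x. p x \<in> convex_cone hull S}"
    unfolding D_def
  proof (rule closure_minimal[OF hull_minimal])
    show "convex_cone {x. p x \<in> convex_cone hull S}"
      by (rule convex_cone_linear_vimage[OF p(1) convex_cone_convex_cone_hull])
    show "closed {x. p x \<in> convex_cone hull S}"
      using continuous_closed_vimage[OF clS, of p] p(1)
      by (simp add: vimage_def linear_continuous_at linear_linear)
  qed (use proj in auto)
  have "D \<subseteq> ?K"
  proof
    fix x assume "x \<in> D"
    then have "p x \<in> ?K"
      using \<open>D \<subseteq> _\<close> SK by blast
    moreover have "x - p x \<in> ?K"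
      using p(2) LK by blast
    \<comment> \<open>The first summand comes from the cone over \<open>S\<close>, the second from
      \<open>L\<close>; both are generated by normals without taking closures.\<close>
    ultimately have "p x + (x - p x) \<in> ?K"
      by (rule convex_cone_hull_add)
    then show "x \<in> ?K" by simp
  qed
  then show ?thesis
    unfolding D_def closure_subset_eq .
qed

section \<open>Conic combinations of normals and isometry\<close>

text \<open>The normal at \<open>b\<close> is null, so expanding the form on the combination gives a
  zero sum of nonnegative terms. Each term vanishes, and positive weights leave the form itself
  zero.\<close>

lemma isometric_of_normal_combination:
  fixes x :: "'i \<Rightarrow> 'b"
  assumes "finite I" and b: "norm b = 1"
    and x: "\<And>i. i \<in> I \<Longrightarrow> 0 \<le> l i \<and> norm (x i) = 1"
    and eq: "cut_normal \<Gamma> b = (\<Sum>i\<in>I. l i *\<^sub>R cut_normal \<Gamma> (x i))"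
    and ij: "i \<in> I" "j \<in> I" "0 < l i" "0 < l j"
  shows "norm (\<Gamma> (x i) - \<Gamma> (x j)) = norm (x i - x j)"
proof -
  let ?a = "\<lambda>i. cut_normal \<Gamma> (x i)"
  have "(\<Sum>i\<in>I. \<Sum>j\<in>I. l i * l j * lorentz (?a i) (?a j)) = 0"
    using lorentz_null_cut_normal[OF b] unfolding eq lorentz_sum .
  moreover have nonneg: "0 \<le> l i * l j * lorentz (?a i) (?a j)" if "i \<in> I" "j \<in> I" for i j
    using x that by (simp add: lorentz_cut_normal_nonneg)
  ultimately have "(\<Sum>j\<in>I. l i * l j * lorentz (?a i) (?a j)) = 0"
    using \<open>finite I\<close> ij(1) by (subst (asm) sum_nonneg_eq_0_iff) (auto intro!: sum_nonneg)
  then have "l i * l j * lorentz (?a i) (?a j) = 0"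
    using \<open>finite I\<close> ij nonneg by (subst (asm) sum_nonneg_eq_0_iff) auto
  then show ?thesis
    using ij x by (simp add: lorentz_cut_normal_eq_0_iff)
qed

text \<open>Isometry makes the lifted combination \<open>z\<close> null, so its first component has
  norm 1 like \<open>b\<close>. Nonnegative pairing with the normal at \<open>b\<close> then puts
  \<open>\<Gamma> b\<close> and \<open>fst z\<close> in the equality case of Cauchy-Schwarz.\<close>

lemma isometric_combination:
  assumes "finite I" and b: "norm b = 1"
    and x: "\<And>i. i \<in> I \<Longrightarrow> 0 \<le> l i \<and> norm (x i) = 1"
    and iso: "\<And>i j. i \<in> I \<Longrightarrow> j \<in> I \<Longrightarrow> norm (\<Gamma> (x i) - \<Gamma> (x j)) = norm (x i - x j)"
    and eq: "b = (\<Sum>i\<in>I. l i *\<^sub>R x i)"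
  shows "cut_normal \<Gamma> b = (\<Sum>i\<in>I. l i *\<^sub>R cut_normal \<Gamma> (x i))"
proof -
  define z where "z = (\<Sum>i\<in>I. l i *\<^sub>R cut_normal \<Gamma> (x i))"
  have snd: "snd z = - b"
    by (simp add: z_def eq snd_sum cut_normal_def sum_negf)
  have "lorentz z z = 0"
    unfolding z_def lorentz_sum using x iso
    by (intro sum.neutral ballI) (simp add: lorentz_cut_normal_eq_0_iff)
  then have norm: "norm (fst z) = 1"
    using b by (simp add: lorentz_def snd norm_eq_1)
  have "lorentz (cut_normal \<Gamma> b) z = (\<Sum>i\<in>I. l i * lorentz (cut_normal \<Gamma> b) (cut_normal \<Gamma> (x i)))"
    by (simp add: z_def lorentz_sum_right lorentz_simps)
  also have "\<dots> \<ge> 0"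
    using b x by (intro sum_nonneg mult_nonneg_nonneg lorentz_cut_normal_nonneg) auto
  finally have "1 \<le> \<Gamma> b \<bullet> fst z"
    using b by (simp add: lorentz_def snd cut_normal_def norm_eq_1)
  then have "\<Gamma> b = fst z"
    using norm_\<Gamma>[OF b] norm by (intro eq_if_inner_ge[of "\<Gamma> b" 1]) simp_all
  then show ?thesis
    unfolding z_def[symmetric] using snd by (simp add: cut_normal_def prod_eq_iff)
qed

end

section \<open>Polyhedrality\<close>

lemma cut_set_eq: "cut_set \<Gamma> B = {z. \<forall>a\<in>cut_normal \<Gamma> ` B. 0 \<le> a \<bullet> z}"
  by (auto simp: cut_set_def cut_normal_def inner_Pair)

lemma polyhedron_cut_set:
  assumes "finite B"
  shows "polyhedron (cut_set \<Gamma> B)"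
proof -
  have "cut_set \<Gamma> B = (\<Inter>a\<in>cut_normal \<Gamma> ` B. {z. 0 \<le> a \<bullet> z})"
    unfolding cut_set_eq by auto
  also have "polyhedron \<dots>"
    using assms by (intro polyhedron_Inter) (auto simp: polyhedron_halfspace_ge)
  finally show ?thesis .
qed

text \<open>Every normal is a conic combination of normals at points of \<open>I\<close>, so the
  cuts from \<open>I\<close> imply all others.\<close>

lemma C_set_eq_cut_set:
  fixes \<Gamma> :: "real ^ 'm \<Rightarrow> real ^ 'n"
  assumes "nonexpansive_sphere_map \<Gamma>" and cover: "isometric_cover \<Gamma> I"
  shows "C_set \<Gamma> = cut_set \<Gamma> I"
proof -
  interpret nonexpansive_sphere_map \<Gamma> by fact
  have I: "I \<subseteq> sphere 0 1"
    using cover by (simp add: isometric_cover_def)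
  show ?thesis
  proof (intro equalityI subsetI)
    fix z assume "z \<in> C_set \<Gamma>"
    then show "z \<in> cut_set \<Gamma> I"
      using I unfolding C_set_def cut_set_eq by auto
  next
    fix z assume z: "z \<in> cut_set \<Gamma> I"
    have "0 \<le> cut_normal \<Gamma> b \<bullet> z" if b: "norm b = 1" for b
    proof -
      have "\<exists>J\<subseteq>I. pairwise (isometric_points \<Gamma>) J \<and> b \<in> convex_cone hull J"
        using cover b by (simp add: isometric_cover_def)
      then obtain J where J: "J \<subseteq> I" "pairwise (isometric_points \<Gamma>) J" "b \<in> convex_cone hull J"
        by blast
      obtain t l x where eq: "b = (\<Sum>i=1..t. l i *\<^sub>R x i)"
          and x: "\<forall>i\<in>{1..t::nat}. 0 \<le> l i \<and> x i \<in> J"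
        using J(3) unfolding convex_cone_hull_eq_conic_combinations by blast
      have "cut_normal \<Gamma> b = (\<Sum>i=1..t. l i *\<^sub>R cut_normal \<Gamma> (x i))"
      proof (rule isometric_combination[OF _ b _ _ eq])
        show "norm (\<Gamma> (x i) - \<Gamma> (x j)) = norm (x i - x j)" if "i \<in> {1..t}" "j \<in> {1..t}" for i j
          \<comment> \<open>\<open>pairwise\<close> speaks only of distinct points, while the family
            \<open>x\<close> may repeat a point.\<close>
          using J(2) x that
          by (cases "x i = x j") (auto simp: pairwise_def isometric_points_def)
        show "0 \<le> l i \<and> norm (x i) = 1" if "i \<in> {1..t}" for i
        proof -
          have "0 \<le> l i" "x i \<in> I"
            using x that J(1) by auto
          then show ?thesis using I by auto
        qed
      qed simp
      then have "cut_normal \<Gamma> b \<bullet> z = (\<Sum>i=1..t. l i * (cut_normal \<Gamma> (x i) \<bullet> z))"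
        by (simp add: inner_sum_left)
      also have "\<dots> \<ge> 0"
      proof (rule sum_nonneg)
        fix i assume "i \<in> {1..t}"
        then have "0 \<le> l i" "x i \<in> I"
          using x J(1) by auto
        then show "0 \<le> l i * (cut_normal \<Gamma> (x i) \<bullet> z)"
          using z by (simp add: cut_set_eq)
      qed
      finally show ?thesis .
    qed
    then show "z \<in> C_set \<Gamma>"
      unfolding C_set_def cut_set_eq by auto
  qed
qed

text \<open>\<open>I\<close> collects the base points of finitely many normals that generate all
  normals; for a given \<open>b\<close>, the points of positive weight serve as
  \<open>J\<close>.\<close>

lemma isometric_cover_of_polyhedron:
  fixes \<Gamma> :: "real ^ 'm \<Rightarrow> real ^ 'n"
  assumes "nonexpansive_sphere_map \<Gamma>" and poly: "polyhedron (C_set \<Gamma>)"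
  shows "\<exists>I. isometric_cover \<Gamma> I"
proof -
  interpret nonexpansive_sphere_map \<Gamma> by fact
  have "polyhedron {z. \<forall>a\<in>normals. 0 \<le> a \<bullet> z}"
    using poly unfolding C_set_def cut_set_eq .
  then obtain T where T: "finite T" "T \<subseteq> normals" "normals \<subseteq> convex_cone hull T"
    by (rule finitely_generated_of_polyhedral_dual[OF closed_cone_normals])
  then obtain I where I: "finite I" "I \<subseteq> sphere 0 1" "T = cut_normal \<Gamma> ` I"
    using finite_subset_image[OF T(1,2)] by blast
  have "\<exists>J\<subseteq>I. pairwise (isometric_points \<Gamma>) J \<and> b \<in> convex_cone hull J" if "norm b = 1" for b
  proof -
    have "cut_normal \<Gamma> b \<in> convex_cone hull (cut_normal \<Gamma> ` I)"
      using T(3) I(3) that by auto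
    then obtain t l y where eq: "cut_normal \<Gamma> b = (\<Sum>i=1..t. l i *\<^sub>R y i)"
        and y: "\<forall>i\<in>{1..t::nat}. 0 \<le> l i \<and> y i \<in> cut_normal \<Gamma> ` I"
      unfolding convex_cone_hull_eq_conic_combinations by blast
    \<comment> \<open>The base point is read off the second component of the normal.\<close>
    define x where "x i = - snd (y i)" for i
    have x: "0 \<le> l i" "x i \<in> I" "norm (x i) = 1" "cut_normal \<Gamma> (x i) = y i" if "i \<in> {1..t}" for i
    proof -
      have "0 \<le> l i" "y i \<in> cut_normal \<Gamma> ` I"
        using y that by auto
      moreover then obtain c where "c \<in> I" "y i = cut_normal \<Gamma> c"
        by blast
      moreover then have "x i = c"
        by (simp add: x_def cut_normal_def)
      ultimately show "0 \<le> l i" "x i \<in> I" "norm (x i) = 1" "cut_normal \<Gamma> (x i) = y i"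
        using I(2) by auto
    qed
    \<comment> \<open>Points of weight 0 are dropped, since the null-vector argument yields isometry
      only for positive weights.\<close>
    define J where "J = x ` {i\<in>{1..t}. 0 < l i}"
    have "J \<subseteq> I"
      using x(2) by (auto simp: J_def)
    moreover have "norm (\<Gamma> (x i) - \<Gamma> (x j)) = norm (x i - x j)"
      if "i \<in> {1..t}" "j \<in> {1..t}" "0 < l i" "0 < l j" for i j
      using x that eq
      by (intro isometric_of_normal_combination[of "{1..t}" b l x]) (auto simp: \<open>norm b = 1\<close>)
    then have "pairwise (isometric_points \<Gamma>) J"
      by (auto simp: pairwise_def J_def isometric_points_def)
    moreover have "b \<in> convex_cone hull J"
    proof -
      have "b = - snd (cut_normal \<Gamma> b)"
        by (simp add: cut_normal_def)
      also have "\<dots> = (\<Sum>i=1..t. l i *\<^sub>R x i)"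
        unfolding eq by (simp add: x_def snd_sum sum_negf)
      also have "\<dots> \<in> convex_cone hull J"
      proof (rule convex_cone_sum[OF convex_cone_convex_cone_hull])
        show "l i *\<^sub>R x i \<in> convex_cone hull J" if "i \<in> {1..t}" for i
        proof (cases "l i = 0")
          case False
          then have "x i \<in> J"
            using x(1)[OF that] that by (simp add: J_def)
          then show ?thesis
            using x(1)[OF that] by (intro convex_cone_hull_mul hull_inc)
        qed (simp add: convex_cone_hull_contains_0)
      qed
      finally show ?thesis .
    qed
    ultimately show ?thesis by blast
  qed
  then have "isometric_cover \<Gamma> I"
    unfolding isometric_cover_def using I(1,2) by simp
  then show ?thesis ..
qed

theorem theorem3:
  fixes \<Gamma> :: "real ^ 'm \<Rightarrow> real ^ 'n"
  assumes "\<Gamma> \<in> sphere 0 1 \<rightarrow> sphere 0 1"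
    and "1-lipschitz_on (sphere 0 1) \<Gamma>"
  shows "(polyhedron (C_set \<Gamma>) \<longleftrightarrow> (\<exists>I. isometric_cover \<Gamma> I)) \<and>
    (\<forall>I. isometric_cover \<Gamma> I \<longrightarrow> C_set \<Gamma> = cut_set \<Gamma> I)"
proof -
  have map: "nonexpansive_sphere_map \<Gamma>"
    using assms by unfold_locales
  \<comment> \<open>This direction follows from the finite description of
    \<open>C_set \<Gamma>\<close>.\<close>
  have "polyhedron (C_set \<Gamma>)" if "isometric_cover \<Gamma> I" for I
    using C_set_eq_cut_set[OF map that] that
    by (simp add: polyhedron_cut_set isometric_cover_def)
  then show ?thesis
    using C_set_eq_cut_set[OF map] isometric_cover_of_polyhedron[OF map] by blast
qed

end
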